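(* Let $1\le k\le M$ and $x>0$. Let $i^*$ be the index of the device with the $k$-th largest harvested energy among $E_1,\dots,E_M$ (energy-based selection, EBS). Then the outage probability $\Pi^{(k)}_{\rm EBS}(x)=\mathbb P\{X_{i^*}\le x\}$ is $$\Pi^{(k)}_{\rm EBS}(x)=1-2k\binom Mk\sqrt{\frac{\sigma_n^2t_2x}{P_tt_1}}\;\sum_{m=0}^{M-k}(-1)^m\binom{M-k}{m}\frac{\Phi(x,m)}{\sqrt{k+m}},$$ where $$\Phi(x,m)=\exp\left(-\frac{\sigma_n^2ct_2x}{t_1(ac-b)}\right)\sqrt{\frac{c^2}{ac-b}}\;K_1\left(2\sqrt{\frac{\sigma_n^2c^2t_2x}{P_tt_1(ac-b)}(k+m)}\right).$$
   Context: There are $M\ge 1$ devices. The channel gains $|g_1|^2,\dots,|g_M|^2,|h_1|^2,\dots,|h_M|^2$ are independent exponential random variables with mean $1$. Parameters: $P_t>0$, $\sigma_n^2>0$, $0<t_1<1$, $t_2=1-t_1$, and real constants $a,b,c$ with $c>0$ and $ac-b>0$. The energy harvested by device $i$ is $E_i=t_1\left(\frac{aP_t|g_i|^2+b}{P_t|g_i|^2+c}-\frac bc\right)$, and the SNR of device $i$ is $X_i=\frac{|h_i|^2}{t_2\sigma_n^2}E_i$. The outage probability at rate threshold $Q>0$ is $\mathbb P\{t_2\log_2(1+X)\le Q\}=\mathbb P\{X\le x\}$ with $x=2^{Q/t_2}-1$. $K_1$ is the modified Bessel function of the second kind of order one. The $E_i$ are almost surely distinct, so $i^*$ is almost surely well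 defined. *)

theory Defs
  imports "HOL-Probability.Probability"
begin

text \<open>
  Modified Bessel function of the second kind, of real order \<open>\<nu>\<close> and argument \<open>x > 0\<close>, given by
  its standard integral representation on the half line (DLMF 10.32.9).  The integral
  converges for every \<open>\<nu>\<close> when \<open>x > 0\<close>, see \<open>bessel_K_integrable\<close>.
\<close>

definition bessel_K :: "real \<Rightarrow> real \<Rightarrow> real" where
  "bessel_K \<nu> x = (LBINT t:{0..}. exp (- x * cosh t) * cosh (\<nu> * t))"

lemma cosh_ge_quadratic: "1 + t\<^sup>2 / 2 \<le> cosh (t :: real)"
proof -
  have "cosh t = 1 + 2 * (sinh (t/2))\<^sup>2"
    using cosh_double[of "t/2"] cosh_square_eq[of "t/2"] by simp
  moreover have "(t/2)\<^sup>2 \<le> (sinh (t/2))\<^sup>2"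
  proof -
    have pos: "s \<le> sinh s" if "0 \<le> s" for s :: real
    proof -
      have "sinh 0 - 0 \<le> sinh s - s"
        by (rule DERIV_nonneg_imp_nondecreasing[OF that, of "\<lambda>s. sinh s - s"])
           (auto intro!: exI derivative_eq_intros simp: cosh_real_ge_1)
      then show ?thesis by simp
    qed
    have "\<bar>t/2\<bar> \<le> \<bar>sinh (t/2)\<bar>"
      using pos[of "\<bar>t/2\<bar>"] by (simp only: abs_ge_zero sinh_real_abs)
    then show ?thesis using abs_le_square_iff by blast
  qed
  ultimately show ?thesis by (simp add: power_divide)
qed

lemma bessel_K_integrable:
  fixes x \<nu> :: real
  assumes "0 < x"
  shows "set_integrable lborel {0..} (\<lambda>t. exp (- x * cosh t) * cosh (\<nu> * t))"
proof -
  define \<mu> \<sigma> where "\<mu> = \<bar>\<nu>\<bar> / x" and "\<sigma> = 1 / sqrt x"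
  define C where "C = exp (\<nu>\<^sup>2 / (2 * x)) * sqrt (2 * pi * \<sigma>\<^sup>2)"
  have \<sigma>: "0 < \<sigma>" "\<sigma>\<^sup>2 = 1 / x" using assms by (auto simp: \<sigma>_def power_divide)
  have bound: "\<bar>exp (- x * cosh t) * cosh (\<nu> * t)\<bar> \<le> C * normal_density \<mu> \<sigma> t" if "0 \<le> t" for t
  proof -
    have "cosh (\<nu> * t) \<le> exp (\<bar>\<nu>\<bar> * t)"
    proof -
      have "cosh (\<nu> * t) = cosh (\<bar>\<nu>\<bar> * t)"
        using that by (metis abs_mult abs_of_nonneg cosh_real_abs)
      also have "\<dots> \<le> exp (\<bar>\<nu>\<bar> * t)"
      proof -
        have "exp (- (\<bar>\<nu>\<bar> * t)) \<le> exp (\<bar>\<nu>\<bar> * t)" using that by simp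
        then show ?thesis unfolding cosh_field_def by simp
      qed
      finally show ?thesis .
    qed
    moreover have "exp (- x * cosh t) \<le> exp (- x * (t\<^sup>2 / 2))"
    proof -
      have "t\<^sup>2 / 2 \<le> cosh t" using cosh_ge_quadratic[of t] by simp
      then show ?thesis using assms by simp
    qed
    ultimately have "exp (- x * cosh t) * cosh (\<nu> * t) \<le> exp (- x * (t\<^sup>2 / 2)) * exp (\<bar>\<nu>\<bar> * t)"
      by (intro mult_mono) auto
    also have "\<dots> = exp (\<nu>\<^sup>2 / (2 * x)) * exp (- (t - \<mu>)\<^sup>2 / (2 * \<sigma>\<^sup>2))"
    proof -
      have "- x * (t\<^sup>2 / 2) + \<bar>\<nu>\<bar> * t = \<nu>\<^sup>2 / (2 * x) + - (t - \<mu>)\<^sup>2 / (2 * \<sigma>\<^sup>2)"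
      proof -
        have "x * \<mu> = \<bar>\<nu>\<bar>" using assms by (simp add: \<mu>_def)
        then have "\<nu>\<^sup>2 / (2 * x) = x * \<mu>\<^sup>2 / 2"
          using assms by (simp add: \<mu>_def power_divide power2_eq_square)
        moreover have "- (t - \<mu>)\<^sup>2 / (2 * \<sigma>\<^sup>2) = - x * (t - \<mu>)\<^sup>2 / 2"
          using assms unfolding \<sigma>(2) by simp
        ultimately show ?thesis
          unfolding \<open>x * \<mu> = \<bar>\<nu>\<bar>\<close>[symmetric] by (simp only:) (simp add: power2_eq_square field_simps)
      qed
      then show ?thesis by (metis exp_add)
    qed
    also have "\<dots> = C * normal_density \<mu> \<sigma> t"
      using assms \<sigma> by (simp add: C_def normal_density_def)
    finally show ?thesis by simp
  qed
  show ?thesis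
    unfolding set_integrable_def
  proof (rule Bochner_Integration.integrable_bound)
    show "integrable lborel (\<lambda>t. C * normal_density \<mu> \<sigma> t)"
      using \<sigma> by simp
    have "continuous_on {0..} (\<lambda>t. exp (- x * cosh t) * cosh (\<nu> * t))"
      by (intro continuous_intros)
    then have "(\<lambda>t. indicator {0..} t *\<^sub>R (exp (- x * cosh t) * cosh (\<nu> * t))) \<in> borel_measurable borel"
      by (intro borel_measurable_continuous_on_indicator) auto
    then show "(\<lambda>t. indicator {0..} t *\<^sub>R (exp (- x * cosh t) * cosh (\<nu> * t)))
        \<in> borel_measurable lborel"
      by simp
    have "0 \<le> C" by (simp add: C_def)
    then show "AE t in lborel. norm (indicator {0..} t *\<^sub>R (exp (- x * cosh t) * cosh (\<nu> * t)))
        \<le> norm (C * normal_density \<mu> \<sigma> t)"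
      using bound by (intro AE_I2) (auto simp: indicator_def)
  qed
qed

text \<open>In the next two definitions \<open>\<gamma>\<close> and \<open>\<eta>\<close> are the power gains \<open>|g|\<^sup>2\<close> and \<open>|h|\<^sup>2\<close>.\<close>

definition harvested_energy :: "real \<Rightarrow> real \<Rightarrow> real \<Rightarrow> real \<Rightarrow> real \<Rightarrow> real \<Rightarrow> real" where
  "harvested_energy a b c P\<^sub>t t\<^sub>1 \<gamma> = t\<^sub>1 * ((a * P\<^sub>t * \<gamma> + b) / (P\<^sub>t * \<gamma> + c) - b / c)"

definition snr :: "real \<Rightarrow> real \<Rightarrow> real \<Rightarrow> real \<Rightarrow> real" where
  "snr noise_var t\<^sub>2 \<eta> E = \<eta> / (t\<^sub>2 * noise_var) * E"

text \<open>
  The two cardinality conditions say that \<open>E i\<close> is the \<open>k\<close>-th largest of the values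
  \<open>E j\<close>, \<open>j \<in> I\<close>, counted with multiplicity.  Ties are broken in favour of the smallest index,
  so that the result always lies in \<open>I\<close>; without ties, exactly one index qualifies.
\<close>

definition kth_largest_index :: "nat \<Rightarrow> nat set \<Rightarrow> (nat \<Rightarrow> real) \<Rightarrow> nat" where
  "kth_largest_index k I E =
     (LEAST i. i \<in> I \<and> card {j\<in>I. E j > E i} < k \<and> k \<le> card {j\<in>I. E j \<ge> E i})"

lemma kth_largest_exists:
  fixes E :: "nat \<Rightarrow> real"
  assumes "finite I" "1 \<le> k" "k \<le> card I"
  shows "\<exists>i. i \<in> I \<and> card {j\<in>I. E j > E i} < k \<and> k \<le> card {j\<in>I. E j \<ge> E i}"
proof -
  define S where "S = {v \<in> E ` I. k \<le> card {j\<in>I. E j \<ge> v}}"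
  have fin: "finite S" using assms by (simp add: S_def)
  have ne: "E ` I \<noteq> {}" using assms by auto
  have "Min (E ` I) \<in> S"
  proof -
    have "{j\<in>I. E j \<ge> Min (E ` I)} = I" using assms(1) by auto
    then show ?thesis using assms ne by (simp add: S_def)
  qed
  then have "Max S \<in> S" using fin Max_in by blast
  then obtain i where i: "i \<in> I" "E i = Max S" "k \<le> card {j\<in>I. E j \<ge> E i}"
    unfolding S_def by force
  have "card {j\<in>I. E j > E i} < k"
  proof (rule ccontr)
    assume neg: "\<not> ?thesis"
    define T where "T = {j\<in>I. E j > E i}"
    have T: "finite T" "k \<le> card T" using neg assms by (auto simp: T_def)
    then have neT: "E ` T \<noteq> {}" using assms by auto
    define v where "v = Min (E ` T)"
    have v: "v \<in> E ` T" using neT T v_def by simp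
    have "T \<subseteq> {j\<in>I. E j \<ge> v}" using T(1) by (auto simp: v_def T_def)
    then have "k \<le> card {j\<in>I. E j \<ge> v}"
      using T(2) assms(1) card_mono[of "{j\<in>I. E j \<ge> v}" T] by simp
    then have "v \<in> S" using v by (auto simp: S_def T_def)
    then have "v \<le> E i" using fin i by simp
    then show False using v by (auto simp: T_def)
  qed
  then show ?thesis using i by blast
qed

lemma kth_largest_index_mem:
  assumes "finite I" "1 \<le> k" "k \<le> card I"
  shows "kth_largest_index k I E \<in> I"
  using LeastI_ex[OF kth_largest_exists[OF assms, of E]]
  unfolding kth_largest_index_def by blast

lemma kth_largest_iff_inj:
  fixes E :: "nat \<Rightarrow> real"
  assumes "finite I" "inj_on E I" "1 \<le> k" "i \<in> I"
  shows "card {j\<in>I. E j > E i} < k \<and> k \<le> card {j\<in>I. E j \<ge> E i}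
           \<longleftrightarrow> card {j\<in>I. E j > E i} = k - 1"
proof -
  have "{j\<in>I. E j \<ge> E i} = insert i {j\<in>I. E j > E i}"
    using assms by (force simp: inj_on_def)
  then show ?thesis using assms by auto
qed

end

theory Submission
  imports Defs
begin

text \<open>
  The harvested energy increases with the gain, so almost surely the selected device is the one with
  the \<open>k\<close>-th largest gain.  With \<open>g\<close> that gain and \<open>h\<close> the independent second-hop gain, the SNR
  exceeds \<open>x\<close> iff \<open>h > A + B / g\<close> for constants \<open>A, B > 0\<close>.  Conditioning on \<open>g\<close>, whose density is
  \<open>k (M choose k) exp (- k g) (1 - exp (- g)) ^ (M - k)\<close>, and expanding binomially leaves the
  integrals of \<open>exp (- s g - B / g)\<close> over \<open>g > 0\<close>, which are Bessel functions.
\<close>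

section \<open>Integral representations of \<open>bessel_K 1\<close>\<close>

text \<open>Split \<open>exp u = cosh u + sinh u\<close>: the even \<open>cosh\<close> part doubles
  the half-line integral that defines \<open>bessel_K 1\<close>, and the odd \<open>sinh\<close>
  part cancels. An exponential substitution on the half line \<open>g > 0\<close> produces exactly
  this whole-line form.\<close>

lemma has_bochner_integral_exp_cosh:
  fixes z :: real
  assumes "0 < z"
  shows "has_bochner_integral lborel (\<lambda>u. exp (- z * cosh u) * exp u) (2 * bessel_K 1 z)"
proof -
  let ?c = "\<lambda>u. exp (- z * cosh u) * cosh u" and ?s = "\<lambda>u. exp (- z * cosh u) * sinh u"
  have ic: "set_integrable lborel {0..} ?c"
    using bessel_K_integrable[OF assms, of 1] by simp
  then have "has_bochner_integral lborel (\<lambda>u. indicator {0..} u *\<^sub>R ?c u) (bessel_K 1 z)"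
    unfolding bessel_K_def set_integrable_def set_lebesgue_integral_def
    by (simp add: has_bochner_integral_iff)
  then have c: "has_bochner_integral lborel ?c (2 *\<^sub>R bessel_K 1 z)"
    by (rule has_bochner_integral_even_function) simp
  have "continuous_on {0..} ?s" by (intro continuous_intros)
  then have "(\<lambda>t. indicator {0..} t *\<^sub>R ?s t) \<in> borel_measurable borel"
    by (intro borel_measurable_continuous_on_indicator) auto
  \<comment> \<open>Domination by the \<open>cosh\<close> integrand. The odd part must be integrable
    before its integral can be cancelled by symmetry.\<close>
  moreover have "\<bar>sinh u\<bar> \<le> \<bar>cosh u\<bar>" for u :: real
    using sinh_less_cosh_real[of "\<bar>u\<bar>"]
    by (simp only: cosh_real_abs sinh_real_abs cosh_real_nonneg abs_of_nonneg)
  ultimately have "set_integrable lborel {0..} ?s"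
    using ic unfolding set_integrable_def
    by (elim Bochner_Integration.integrable_bound)
       (auto intro!: AE_I2 simp: indicator_def abs_mult less_imp_le sinh_less_cosh_real)
  then have "has_bochner_integral lborel (\<lambda>u. indicator {0..} u *\<^sub>R ?s u) (LBINT u:{0..}. ?s u)"
    unfolding set_integrable_def set_lebesgue_integral_def by (simp add: has_bochner_integral_iff)
  then have s: "has_bochner_integral lborel ?s 0"
    by (rule has_bochner_integral_odd_function) simp
  have "exp u = cosh u + sinh u" for u :: real
    by (simp add: cosh_plus_sinh)
  then have "(\<lambda>u. exp (- z * cosh u) * exp u) = (\<lambda>u. ?c u + ?s u)"
    by (simp add: fun_eq_iff distrib_left)
  then show ?thesis
    using has_bochner_integral_add[OF c s] by simp
qed

text \<open>The substitution \<open>g = sqrt (B / s) * exp u\<close> makes the exponent proportional to \<open>cosh u\<close>.\<close>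

lemma has_bochner_integral_exp_inverse_bessel_K:
  fixes B s :: real
  assumes "0 < B" "0 < s"
  shows "has_bochner_integral lborel (\<lambda>g. indicator {0<..} g *\<^sub>R exp (- (s * g) - B / g))
           (2 * sqrt (B / s) * bessel_K 1 (2 * sqrt (B * s)))"
proof -
  define r z where "r = sqrt (B / s)" and "z = 2 * sqrt (B * s)"
  have r: "0 < r" and z: "0 < z" using assms by (auto simp: r_def z_def)
  define f where "f = (\<lambda>g. exp (- (s * g) - B / g))"
  have rs: "r = sqrt B / sqrt s"
    by (simp add: r_def real_sqrt_divide)
  \<comment> \<open>The scale \<open>r\<close> is the one at which the coefficients of
    \<open>exp u\<close> and \<open>exp (- u)\<close>, namely \<open>s * r\<close> and
    \<open>B / r\<close>, coincide. Their common value \<open>sqrt (B * s)\<close> is half of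
    \<open>z\<close>.\<close>
  have sr: "s * r = sqrt (B * s)"
  proof -
    have "s * r = (s / sqrt s) * sqrt B" by (simp add: rs)
    then show ?thesis using assms by (simp add: real_div_sqrt real_sqrt_mult)
  qed
  have Br: "B / r = sqrt (B * s)"
  proof -
    have "B / r = (B / sqrt B) * sqrt s" by (simp add: rs)
    then show ?thesis using assms by (simp add: real_div_sqrt real_sqrt_mult)
  qed
  have f: "f (r * exp u) = exp (- z * cosh u)" for u
  proof -
    have "s * (r * exp u) + B / (r * exp u) = (s * r) * exp u + (B / r) * exp (- u)"
      by (simp add: exp_minus field_simps)
    also have "\<dots> = z * cosh u"
      unfolding sr Br z_def cosh_field_def by (simp add: algebra_simps)
    finally show ?thesis by (simp add: f_def)
  qed
  have H: "has_bochner_integral lborel (\<lambda>u. f (r * exp u) * (r * exp u)) (r * (2 * bessel_K 1 z))"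
    using has_bochner_integral_mult_right[OF has_bochner_integral_exp_cosh[OF z], of r]
    by (simp add: f algebra_simps)
  have int: "set_integrable lborel (einterval (-\<infinity>) \<infinity>) (\<lambda>u. f (r * exp u) * (r * exp u))"
    using H by (simp add: set_integrable_def has_bochner_integral_iff)
  \<comment> \<open>The limits at both ends show that \<open>u\<close> over the whole line sweeps
    out the half line \<open>g > 0\<close>.\<close>
  have A: "((ereal \<circ> (\<lambda>u. r * exp u) \<circ> real_of_ereal) \<longlongrightarrow> 0) (at_right (-\<infinity>))"
  proof -
    have "((\<lambda>u. r * exp u) \<longlongrightarrow> r * 0) at_bot"
      by (intro tendsto_intros exp_at_bot)
    then show ?thesis
      unfolding zero_ereal_def by (simp add: ereal_tendsto_simps)
  qed
  have B: "((ereal \<circ> (\<lambda>u. r * exp u) \<circ> real_of_ereal) \<longlongrightarrow> \<infinity>) (at_left \<infinity>)"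
  proof -
    have "LIM u at_top. r * exp u :> at_top"
      using r exp_at_top by (intro filterlim_tendsto_pos_mult_at_top[OF tendsto_const])
    then show ?thesis by (simp add: ereal_tendsto_simps)
  qed
  have eq: "einterval 0 \<infinity> = {0<..}"
    by (auto simp: einterval_def)
  have d: "DERIV (\<lambda>u. r * exp u) u :> r * exp u" for u
    by (auto intro!: derivative_eq_intros)
  have cf: "isCont f (r * exp u)" for u
    unfolding f_def using r by (intro continuous_intros) auto
  have cg: "isCont (\<lambda>u. r * exp u) u" for u
    by (intro continuous_intros)
  have nn: "0 \<le> f (r * exp u)" "0 \<le> r * exp u" for u
    using r by (auto simp: f_def)
  \<comment> \<open>For nonnegative integrands the substitution rule also transfers integrability,
    from the \<open>cosh\<close> form back to \<open>f\<close>.\<close>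
  note sub = interval_integral_substitution_nonneg[where a = "-\<infinity>" and b = "\<infinity>" and f = f
      and g = "\<lambda>u. r * exp u" and g' = "\<lambda>u. r * exp u", OF _ d cf cg nn A B int]
  have "set_integrable lborel (einterval 0 \<infinity>) f"
    by (rule sub(1)) simp
  moreover have "(LBINT g=0..\<infinity>. f g) = (LBINT u=-\<infinity>..\<infinity>. f (r * exp u) * (r * exp u))"
    by (rule sub(2)) simp
  moreover have "(LBINT u=-\<infinity>..\<infinity>. f (r * exp u) * (r * exp u)) = r * (2 * bessel_K 1 z)"
    using H by (simp add: interval_lebesgue_integral_def set_lebesgue_integral_def
        has_bochner_integral_iff)
  ultimately show ?thesis
    by (simp add: interval_lebesgue_integral_def set_lebesgue_integral_def eq
        set_integrable_def has_bochner_integral_iff f_def r_def z_def mult_ac)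
qed

section \<open>Conditioning on one variable of an independent family\<close>

text \<open>By independence the joint law is a product measure, so Fubini applies with coordinate
  \<open>i\<close> outermost. Once \<open>X i\<close> is frozen at \<open>y\<close>, the conditions
  constrain each \<open>X j\<close> separately: the event is a box and its measure a
  product.\<close>

lemma (in prob_space) emeasure_indep_vars_conditional:
  fixes X :: "'i \<Rightarrow> 'a \<Rightarrow> real" and P :: "'i \<Rightarrow> real \<Rightarrow> real \<Rightarrow> bool"
  assumes indep: "indep_vars (\<lambda>_. borel) X (insert i J)"
    and J: "finite J" "i \<notin> J"
    and P: "\<And>j. j \<in> J \<Longrightarrow> Measurable.pred (borel \<Otimes>\<^sub>M borel) (\<lambda>(y, z). P j y z)"
  shows "emeasure M {\<omega> \<in> space M. \<forall>j\<in>J. P j (X i \<omega>) (X j \<omega>)} =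
    (\<integral>\<^sup>+ y. (\<Prod>j\<in>J. emeasure M {\<omega> \<in> space M. P j y (X j \<omega>)}) \<partial>distr M borel (X i))"
proof -
  let ?K = "insert i J" and ?N = "\<lambda>_. borel :: real measure"
  have rv: "random_variable borel (X j)" if "j \<in> ?K" for j
    using indep that by (auto simp: indep_vars_def)
  \<comment> \<open>Extending the family by the constant 0 makes every \<open>D j\<close> a
    probability measure, as the product locale asks for all indices and not just those in
    \<open>?K\<close>.\<close>
  define Y where "Y = (\<lambda>j. if j \<in> ?K then X j else (\<lambda>_. 0))"
  have Y[measurable]: "random_variable borel (Y j)" for j
    using rv by (auto simp: Y_def)
  define D where "D = (\<lambda>j. distr M borel (Y j))"
  interpret D: product_prob_space D ?K
    unfolding product_prob_space_def product_sigma_finite_def product_prob_space_axioms_def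
    by (auto simp: D_def intro!: prob_space_distr prob_space_imp_sigma_finite)
  have sD[measurable_cong, simp]: "sets (D j) = sets borel" for j by (simp add: D_def)
  have spD[simp]: "space (D j) = UNIV" for j by (simp add: D_def)
  have sPi: "sets (Pi\<^sub>M L D) = sets (Pi\<^sub>M L ?N)" for L
    by (intro sets_PiM_cong) auto
  have "indep_vars ?N Y ?K"
    using indep by (rule indep_vars_cong[THEN iffD1, rotated -1]) (auto simp: Y_def)
  then have joint: "distr M (Pi\<^sub>M ?K ?N) (\<lambda>\<omega>. \<lambda>j\<in>?K. Y j \<omega>) = Pi\<^sub>M ?K D"
    unfolding D_def by (subst indep_vars_iff_distr_eq_PiM[symmetric]) auto
  let ?S = "{f \<in> space (Pi\<^sub>M ?K D). \<forall>j\<in>J. P j (f i) (f j)}"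
  have "Measurable.pred (Pi\<^sub>M ?K D) (\<lambda>f. \<forall>j\<in>J. P j (f i) (f j))"
  proof (intro pred_intros_finite J)
    fix j assume j: "j \<in> J"
    have "(\<lambda>f. (f i, f j)) \<in> Pi\<^sub>M ?K D \<rightarrow>\<^sub>M borel \<Otimes>\<^sub>M borel"
      using j by (intro measurable_Pair) measurable
    from measurable_compose[OF this P[OF j]]
    show "Measurable.pred (Pi\<^sub>M ?K D) (\<lambda>f. P j (f i) (f j))" by simp
  qed
  then have S[measurable]: "?S \<in> sets (Pi\<^sub>M ?K D)" by measurable
  have "{\<omega> \<in> space M. \<forall>j\<in>J. P j (X i \<omega>) (X j \<omega>)} =
      (\<lambda>\<omega>. \<lambda>j\<in>?K. Y j \<omega>) -` ?S \<inter> space M"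
    by (auto simp: Y_def space_PiM)
  moreover have "(\<lambda>\<omega>. \<lambda>j\<in>?K. Y j \<omega>) \<in> M \<rightarrow>\<^sub>M Pi\<^sub>M ?K ?N" by measurable
  ultimately have "emeasure M {\<omega> \<in> space M. \<forall>j\<in>J. P j (X i \<omega>) (X j \<omega>)} =
      emeasure (Pi\<^sub>M ?K D) ?S"
    using S sPi by (subst joint[symmetric], subst emeasure_distr) auto
  also have "\<dots> = (\<integral>\<^sup>+ f. indicator ?S f \<partial>Pi\<^sub>M ?K D)" by simp
  also have "\<dots> = (\<integral>\<^sup>+ y. \<integral>\<^sup>+ f. indicator ?S (f(i := y)) \<partial>Pi\<^sub>M J D \<partial>D i)"
    using J by (intro D.product_nn_integral_insert_rev) auto
  also have "\<dots> = (\<integral>\<^sup>+ y. (\<Prod>j\<in>J. emeasure M {\<omega> \<in> space M. P j y (X j \<omega>)}) \<partial>D i)"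
  proof (intro nn_integral_cong)
    fix y
    have Py: "{z. P j y z} \<in> sets borel" if "j \<in> J" for j
    proof -
      have "Measurable.pred borel (\<lambda>z. P j y z)"
        using measurable_compose[OF measurable_Pair1' P[OF that], of y] by simp
      then show ?thesis by (simp add: pred_def)
    qed
    have "(\<integral>\<^sup>+ f. indicator ?S (f(i := y)) \<partial>Pi\<^sub>M J D) =
        (\<integral>\<^sup>+ f. indicator (Pi\<^sub>E J (\<lambda>j. {z. P j y z})) f \<partial>Pi\<^sub>M J D)"
    proof (intro nn_integral_cong)
      fix f assume "f \<in> space (Pi\<^sub>M J D)"
      \<comment> \<open>Since \<open>i\<close> is not in \<open>J\<close>, the update fixes the
        first argument of each \<open>P j\<close> and leaves the second untouched, so membership is
        decided coordinate by coordinate.\<close>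
      then have "f(i := y) \<in> ?S \<longleftrightarrow> f \<in> Pi\<^sub>E J (\<lambda>j. {z. P j y z})"
        using J by (auto simp: space_PiM PiE_iff extensional_def)
      then show "indicator ?S (f(i := y)) = (indicator (Pi\<^sub>E J (\<lambda>j. {z. P j y z})) f :: ennreal)"
        by (simp add: indicator_def)
    qed
    also have "\<dots> = emeasure (Pi\<^sub>M J D) (Pi\<^sub>E J (\<lambda>j. {z. P j y z}))"
      using J Py by (intro nn_integral_indicator sets_PiM_I_finite) auto
    also have "\<dots> = (\<Prod>j\<in>J. emeasure (D j) {z. P j y z})"
      using J Py by (intro D.emeasure_PiM) auto
    also have "\<dots> = (\<Prod>j\<in>J. emeasure M {\<omega> \<in> space M. P j y (X j \<omega>)})"
      using Py unfolding D_def Y_def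
      by (intro prod.cong refl) (subst emeasure_distr, auto intro!: arg_cong[where f="emeasure M"] rv)
    finally show "(\<integral>\<^sup>+ f. indicator ?S (f(i := y)) \<partial>Pi\<^sub>M J D) = \<dots>" .
  qed
  finally show ?thesis by (simp add: D_def Y_def)
qed

section \<open>Rank selection: uniqueness and measurability\<close>

text \<open>Without ties the number of larger values determines the index, so the
  \<open>LEAST\<close> in the definition chooses from a single candidate.\<close>

lemma kth_largest_index_eq_iff:
  fixes E :: "nat \<Rightarrow> real"
  assumes "finite I" "inj_on E I" "1 \<le> k" "k \<le> card I" "i \<in> I"
  shows "kth_largest_index k I E = i \<longleftrightarrow> card {j\<in>I. E i < E j} = k - 1"
proof -
  let ?R = "\<lambda>i. i \<in> I \<and> card {j\<in>I. E j > E i} < k \<and> k \<le> card {j\<in>I. E j \<ge> E i}"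
  have R: "?R i \<longleftrightarrow> i \<in> I \<and> card {j\<in>I. E i < E j} = k - 1" for i
    using kth_largest_iff_inj[OF assms(1-3), of i] by blast
  \<comment> \<open>Moving up from \<open>i\<close> to \<open>i'\<close> loses at least
    \<open>i'\<close> itself from the set of larger values.\<close>
  have less: "card {j\<in>I. E i' < E j} < card {j\<in>I. E i < E j}"
    if "E i < E i'" "i' \<in> I" for i i'
    using that assms(1) by (intro psubset_card_mono) auto
  have uniq: "i = i'" if "?R i" "?R i'" for i i'
    using that less[of i i'] less[of i' i] assms(2) unfolding R inj_on_def
    by (metis less_irrefl linorder_less_linear)
  have ex: "?R (kth_largest_index k I E)"
    unfolding kth_largest_index_def by (rule LeastI_ex) (rule kth_largest_exists[OF assms(1,3,4)])
  show ?thesis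
  proof
    assume "kth_largest_index k I E = i"
    then show "card {j\<in>I. E i < E j} = k - 1" using ex R[of i] by simp
  next
    assume "card {j\<in>I. E i < E j} = k - 1"
    then have "?R i" using R[of i] assms(5) by simp
    then show "kth_largest_index k I E = i" using uniq[OF ex] by simp
  qed
qed

lemma measurable_kth_largest_index [measurable]:
  assumes [measurable]: "\<And>i. i \<in> I \<Longrightarrow> E i \<in> borel_measurable M" and "finite I"
  shows "(\<lambda>\<omega>. kth_largest_index k I (\<lambda>i. E i \<omega>)) \<in> M \<rightarrow>\<^sub>M count_space UNIV"
proof -
  \<comment> \<open>\<open>LEAST\<close> ranges over all naturals, so its measurability rule needs a
    measurable function at every index; outside \<open>I\<close> the value 0 serves as a
    filler.\<close>
  define F where "F = (\<lambda>i \<omega>. if i \<in> I then E i \<omega> else 0)"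
  have [measurable]: "F i \<in> borel_measurable M" for i
    by (cases "i \<in> I") (auto simp: F_def)
  have "kth_largest_index k I (\<lambda>i. E i \<omega>) =
      (LEAST i. i \<in> I \<and> card {j. j \<in> I \<and> F i \<omega> < F j \<omega>} < k \<and> k \<le> card {j. j \<in> I \<and> F i \<omega> \<le> F j \<omega>})" for \<omega>
    unfolding kth_largest_index_def F_def
    by (intro arg_cong[where f=Least] ext) (auto intro!: arg_cong[where f=card] cong: conj_cong)
  then show ?thesis by simp
qed

section \<open>Exponential gains\<close>

lemma (in prob_space) distributed_lborel_AE_neq:
  fixes X :: "'a \<Rightarrow> real"
  assumes "distributed M lborel X f"
  shows "AE \<omega> in M. X \<omega> \<noteq> y"
proof -
  have [measurable]: "X \<in> borel_measurable M"
    using distributed_measurable[OF assms] by simp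
  have "emeasure M (X -` {y} \<inter> space M) = (\<integral>\<^sup>+ x. f x * indicator {y} x \<partial>lborel)"
    by (rule distributed_emeasure[OF assms]) simp
  also have "\<dots> = 0"
  proof -
    have "AE x in lborel. f x * indicator {y} x = 0"
      using AE_lborel_singleton[of y] by eventually_elim simp
    then show ?thesis by (simp add: nn_integral_cong_AE[where v = "\<lambda>_. 0"])
  qed
  finally have "X -` {y} \<inter> space M \<in> null_sets M" by (auto intro!: null_setsI)
  then show ?thesis by (rule AE_I') auto
qed

lemma (in prob_space) distr_borel_exponential:
  assumes "distributed M lborel X (exponential_density l)"
  shows "distr M borel X = density lborel (exponential_density l)"
  using distributed_distr_eq_density[OF assms] by (metis distr_cong sets_lborel)

lemma (in prob_space) emeasure_exponential_gt:
  assumes "distributed M lborel X (exponential_density 1)" "0 \<le> y"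
  shows "emeasure M {\<omega> \<in> space M. y < X \<omega>} = exp (- y)"
  using exponential_distributedD_gt[OF assms] by (simp add: emeasure_eq_measure)

lemma (in prob_space) emeasure_exponential_less:
  assumes "distributed M lborel X (exponential_density 1)" "0 \<le> y"
  shows "emeasure M {\<omega> \<in> space M. X \<omega> < y} = ennreal (1 - exp (- y))"
proof -
  have [measurable]: "X \<in> borel_measurable M"
    using distributed_measurable[OF assms(1)] by simp
  have "prob {\<omega> \<in> space M. X \<omega> < y} = prob {\<omega> \<in> space M. X \<omega> \<le> y}"
  proof (rule finite_measure_eq_AE)
    show "AE \<omega> in M. (\<omega> \<in> {\<omega> \<in> space M. X \<omega> < y}) = (\<omega> \<in> {\<omega> \<in> space M. X \<omega> \<le> y})"
      using distributed_lborel_AE_neq[OF assms(1), of y] by eventually_elim auto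
  qed auto
  then show ?thesis
    using exponential_distributedD_le[OF assms] by (simp add: emeasure_eq_measure)
qed

text \<open>Conditionally on \<open>X i = y\<close>, a tie means \<open>X j = y\<close>, which is
  null because \<open>X j\<close> has a density; integrating over \<open>y\<close> gives 0. The
  singleton \<open>{j}\<close> fits this into the conditioning lemma.\<close>

lemma (in prob_space) AE_indep_exponential_neq:
  fixes X :: "'i \<Rightarrow> 'a \<Rightarrow> real"
  assumes "indep_vars (\<lambda>_. borel) X {i, j}" "i \<noteq> j"
    and "distributed M lborel (X j) f"
  shows "AE \<omega> in M. X i \<omega> \<noteq> X j \<omega>"
proof -
  have [measurable]: "X i \<in> borel_measurable M" "X j \<in> borel_measurable M"
    using assms(1) by (auto simp: indep_vars_def)
  have "emeasure M {\<omega> \<in> space M. \<forall>l\<in>{j}. X i \<omega> = X l \<omega>} =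
      (\<integral>\<^sup>+ y. (\<Prod>l\<in>{j}. emeasure M {\<omega> \<in> space M. y = X l \<omega>}) \<partial>distr M borel (X i))"
    using assms(1,2) by (intro emeasure_indep_vars_conditional) auto
  also have "\<dots> = 0"
  proof -
    have "emeasure M {\<omega> \<in> space M. y = X j \<omega>} = 0" for y
    proof -
      have "AE \<omega> in M. \<not> y = X j \<omega>"
        using distributed_lborel_AE_neq[OF assms(3), of y] by eventually_elim auto
      then show ?thesis by (subst (asm) AE_iff_measurable[OF _ refl]) auto
    qed
    then show ?thesis by simp
  qed
  finally have "{\<omega> \<in> space M. X i \<omega> = X j \<omega>} \<in> null_sets M"
    by (auto intro!: null_setsI)
  then show ?thesis by (rule AE_I') auto
qed

text \<open>Conditionally on \<open>G i = y\<close>, each index in \<open>S\<close> contributes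
  \<open>exp (- y)\<close>, each remaining index \<open>1 - exp (- y)\<close>, and the second hop
  \<open>exp (- \<phi> y)\<close>. The density of \<open>G i\<close> supplies one more factor
  \<open>exp (- y)\<close>, hence the exponent \<open>Suc (card S)\<close>.\<close>

lemma (in prob_space) emeasure_exponential_separated:
  fixes G H :: "nat \<Rightarrow> 'a \<Rightarrow> real" and \<phi> :: "real \<Rightarrow> real"
  assumes indep: "indep_vars (\<lambda>_. borel) (case_sum G H) (I <+> I)"
    and G: "\<And>i. i \<in> I \<Longrightarrow> distributed M lborel (G i) (exponential_density 1)"
    and H: "\<And>i. i \<in> I \<Longrightarrow> distributed M lborel (H i) (exponential_density 1)"
    and I: "finite I" "i \<in> I" "S \<subseteq> I - {i}"
    and \<phi>[measurable]: "\<phi> \<in> borel_measurable borel" and \<phi>0: "\<And>y. 0 < y \<Longrightarrow> 0 \<le> \<phi> y"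
  shows "emeasure M {\<omega> \<in> space M. (\<forall>j\<in>S. G i \<omega> < G j \<omega>) \<and> (\<forall>j\<in>I - {i} - S. G j \<omega> < G i \<omega>) \<and>
      \<phi> (G i \<omega>) < H i \<omega>} =
    (\<integral>\<^sup>+ y. ennreal (indicator {0<..} y *\<^sub>R
      (exp (- (real (Suc (card S)) * y)) * (1 - exp (- y)) ^ (card I - Suc (card S)) * exp (- \<phi> y))) \<partial>lborel)"
proof -
  \<comment> \<open>The sum type handles both hops at once: a left index compares a gain with
    \<open>G i\<close>, a right index compares a second-hop gain with the threshold.\<close>
  define P where "P = case_sum (\<lambda>j y z. if j \<in> S then y < z else z < y) (\<lambda>_ :: nat. \<lambda>y z. \<phi> y < (z :: real))"
  \<comment> \<open>Only the second-hop gain of device \<open>i\<close> enters, next to the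
    first-hop gains of all other devices.\<close>
  define J :: "(nat + nat) set" where "J = insert (Inr i) (Inl ` (I - {i}))"
  let ?X = "case_sum G H"
  have fS: "finite S" using I finite_subset by blast
  have cS: "card (I - {i} - S) = card I - Suc (card S)"
    using I fS by (simp add: card_Diff_subset)
  have indep': "indep_vars (\<lambda>_. borel) ?X (insert (Inl i) J)"
    using I by (intro indep_vars_subset[OF indep]) (auto simp: J_def)
  have "{\<omega> \<in> space M. (\<forall>j\<in>S. G i \<omega> < G j \<omega>) \<and> (\<forall>j\<in>I - {i} - S. G j \<omega> < G i \<omega>) \<and> \<phi> (G i \<omega>) < H i \<omega>} =
      {\<omega> \<in> space M. \<forall>j\<in>J. P j (?X (Inl i) \<omega>) (?X j \<omega>)}"
    using I(3) unfolding J_def P_def by auto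
  also have "emeasure M \<dots> =
      (\<integral>\<^sup>+ y. (\<Prod>j\<in>J. emeasure M {\<omega> \<in> space M. P j y (?X j \<omega>)}) \<partial>distr M borel (?X (Inl i)))"
  proof (rule emeasure_indep_vars_conditional[OF indep'])
    show "Measurable.pred (borel \<Otimes>\<^sub>M borel) (\<lambda>(y, z). P j y z)" for j
    proof (cases j)
      case (Inl l)
      then show ?thesis by (cases "l \<in> S") (simp_all add: P_def)
    next
      case (Inr l)
      then show ?thesis by (simp add: P_def)
    qed
  qed (use I in \<open>auto simp: J_def\<close>)
  also have "\<dots> = (\<integral>\<^sup>+ y. (\<Prod>j\<in>J. emeasure M {\<omega> \<in> space M. P j y (?X j \<omega>)})
      \<partial>density lborel (exponential_density 1))"
    using distr_borel_exponential[OF G[OF I(2)]] by simp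
  also have "\<dots> = (\<integral>\<^sup>+ y. exponential_density 1 y *
      (\<Prod>j\<in>J. emeasure M {\<omega> \<in> space M. P j y (?X j \<omega>)}) \<partial>lborel)"
  proof (intro nn_integral_density)
    have "(\<lambda>y. emeasure M {\<omega> \<in> space M. P j y (?X j \<omega>)}) \<in> borel_measurable lborel" if "j \<in> J" for j
    proof -
      have [measurable]: "?X j \<in> borel_measurable M"
        using indep' that by (auto simp: indep_vars_def)
      show ?thesis
      proof (cases j)
        case (Inl l)
        then have [measurable]: "G l \<in> borel_measurable M"
          using \<open>?X j \<in> borel_measurable M\<close> by simp
        show ?thesis using Inl by (cases "l \<in> S") (simp_all add: P_def)
      next
        case (Inr l)
        then have [measurable]: "H l \<in> borel_measurable M"
          using \<open>?X j \<in> borel_measurable M\<close> by simp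
        show ?thesis using Inr by (simp add: P_def)
      qed
    qed
    then show "(\<lambda>y. \<Prod>j\<in>J. emeasure M {\<omega> \<in> space M. P j y (?X j \<omega>)}) \<in> borel_measurable lborel"
      by (rule borel_measurable_prod_ennreal)
  qed auto
  also have "\<dots> = (\<integral>\<^sup>+ y. ennreal (indicator {0<..} y *\<^sub>R
      (exp (- (real (Suc (card S)) * y)) * (1 - exp (- y)) ^ (card I - Suc (card S)) * exp (- \<phi> y))) \<partial>lborel)"
  proof (rule nn_integral_cong_AE)
    have pos: "exponential_density 1 y * (\<Prod>j\<in>J. emeasure M {\<omega> \<in> space M. P j y (?X j \<omega>)}) =
      ennreal (exp (- (real (Suc (card S)) * y)) * (1 - exp (- y)) ^ (card I - Suc (card S)) * exp (- \<phi> y))"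
      if y: "0 < y" for y
    proof -
      have "(\<Prod>j\<in>J. emeasure M {\<omega> \<in> space M. P j y (?X j \<omega>)}) =
          emeasure M {\<omega> \<in> space M. \<phi> y < H i \<omega>} *
          (\<Prod>j\<in>I - {i}. emeasure M {\<omega> \<in> space M. if j \<in> S then y < G j \<omega> else G j \<omega> < y})"
        using I by (simp add: J_def P_def prod.insert_if prod.reindex image_iff)
      also have "(\<Prod>j\<in>I - {i}. emeasure M {\<omega> \<in> space M. if j \<in> S then y < G j \<omega> else G j \<omega> < y}) =
          (\<Prod>j\<in>I - {i}. ennreal (if j \<in> S then exp (- y) else 1 - exp (- y)))"
        using y G by (intro prod.cong) (auto simp: emeasure_exponential_gt emeasure_exponential_less)
      also have "\<dots> = ennreal (\<Prod>j\<in>I - {i}. if j \<in> S then exp (- y) else 1 - exp (- y))"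
        using y by (intro prod_ennreal) auto
      also have "(\<Prod>j\<in>I - {i}. if j \<in> S then exp (- y) else 1 - exp (- y)) =
          exp (- y) ^ card S * (1 - exp (- y)) ^ (card I - Suc (card S))"
      proof -
        have "I - {i} = S \<union> (I - {i} - S)" using I by auto
        then have "(\<Prod>j\<in>I - {i}. if j \<in> S then exp (- y) else 1 - exp (- y)) =
            (\<Prod>j\<in>S. if j \<in> S then exp (- y) else 1 - exp (- y)) *
            (\<Prod>j\<in>I - {i} - S. if j \<in> S then exp (- y) else 1 - exp (- y))"
          using I(1) fS by (subst prod.union_disjoint[symmetric]) auto
        then show ?thesis by (simp add: cS)
      qed
      also have "emeasure M {\<omega> \<in> space M. \<phi> y < H i \<omega>} = exp (- \<phi> y)"
        using H[OF I(2)] \<phi>0[OF y] by (rule emeasure_exponential_gt)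
      also have "exponential_density 1 y *
          (ennreal (exp (- \<phi> y)) * ennreal (exp (- y) ^ card S * (1 - exp (- y)) ^ (card I - Suc (card S)))) =
          ennreal (exp (- y) * (exp (- \<phi> y) * (exp (- y) ^ card S * (1 - exp (- y)) ^ (card I - Suc (card S)))))"
        using y by (simp add: exponential_density_def ennreal_mult)
      also have "exp (- y) * (exp (- \<phi> y) * (exp (- y) ^ card S * (1 - exp (- y)) ^ (card I - Suc (card S)))) =
          exp (- y) ^ Suc (card S) * (1 - exp (- y)) ^ (card I - Suc (card S)) * exp (- \<phi> y)"
        by simp
      also have "exp (- y) ^ Suc (card S) = exp (- (real (Suc (card S)) * y))"
        by (simp only: exp_of_nat_mult[symmetric] mult_minus_right)
      finally show ?thesis .
    qed
    \<comment> \<open>At \<open>y = 0\<close> the density is 1 while the indicator is 0, so the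
      integrands may differ there; for \<open>y < 0\<close> both vanish.\<close>
    show "AE y in lborel. exponential_density 1 y * (\<Prod>j\<in>J. emeasure M {\<omega> \<in> space M. P j y (?X j \<omega>)}) =
      ennreal (indicator {0<..} y *\<^sub>R (exp (- (real (Suc (card S)) * y)) *
        (1 - exp (- y)) ^ (card I - Suc (card S)) * exp (- \<phi> y)))"
      using AE_lborel_singleton[of 0]
    proof eventually_elim
      case (elim y)
      then show ?case
        using pos[of y] by (cases "0 < y") (auto simp: exponential_density_def)
    qed
  qed
  finally show ?thesis .
qed

section \<open>Integration over the selected gain\<close>

text \<open>The binomial theorem for \<open>(1 - exp (- y)) ^ n\<close> adds \<open>m\<close> to the
  decay rate \<open>k\<close>. Each term is then the Bessel integral with \<open>s = k + m\<close>,
  and \<open>exp (- A)\<close> factors out.\<close>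

lemma has_bochner_integral_binomial_bessel_K:
  fixes A B :: real
  assumes "0 < B" "1 \<le> k"
  shows "has_bochner_integral lborel
    (\<lambda>y. indicator {0<..} y *\<^sub>R (exp (- (real k * y)) * (1 - exp (- y)) ^ n * exp (- (A + B / y))))
    (exp (- A) * (\<Sum>m\<le>n. (-1) ^ m * real (n choose m) *
      (2 * sqrt (B / real (k + m)) * bessel_K 1 (2 * sqrt (B * real (k + m))))))"
proof -
  have eq: "exp (- (real k * y)) * (1 - exp (- y)) ^ n * exp (- (A + B / y)) =
      exp (- A) * (\<Sum>m\<le>n. (-1) ^ m * real (n choose m) * exp (- (real (k + m) * y) - B / y))" for y
  proof -
    have e: "exp (- (real (k + m) * y) - B / y) = exp (- (real k * y)) * exp (- y) ^ m * exp (- (B / y))" for m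
      by (simp add: exp_of_nat_mult[symmetric] exp_add[symmetric] algebra_simps)
    have "(1 - exp (- y)) ^ n = (\<Sum>m\<le>n. (-1) ^ m * real (n choose m) * exp (- y) ^ m)"
      using binomial_ring[of "- exp (- y)" 1 n]
      by (simp add: power_minus[of "exp (- y)"] mult_ac)
    then show ?thesis
      unfolding e by (simp add: sum_distrib_left sum_distrib_right exp_add exp_diff exp_minus divide_inverse mult_ac)
  qed
  have "has_bochner_integral lborel
    (\<lambda>y. exp (- A) * (\<Sum>m\<le>n. ((-1) ^ m * real (n choose m)) *
       (indicator {0<..} y *\<^sub>R exp (- (real (k + m) * y) - B / y))))
    (exp (- A) * (\<Sum>m\<le>n. ((-1) ^ m * real (n choose m)) *
      (2 * sqrt (B / real (k + m)) * bessel_K 1 (2 * sqrt (B * real (k + m))))))"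
    using assms
    by (intro has_bochner_integral_mult_right has_bochner_integral_sum
        has_bochner_integral_exp_inverse_bessel_K) auto
  moreover have "exp (- A) * (\<Sum>m\<le>n. ((-1) ^ m * real (n choose m)) *
       (indicator {0<..} y *\<^sub>R exp (- (real (k + m) * y) - B / y))) =
     indicator {0<..} y *\<^sub>R (exp (- (real k * y)) * (1 - exp (- y)) ^ n * exp (- (A + B / y)))" for y
    unfolding eq by (cases "0 < y") simp_all
  ultimately show ?thesis by simp
qed

section \<open>Selection by rank among the gains\<close>

text \<open>The definition refers to the values only through comparisons. This allows energies to be
  replaced by gains, which are ordered in the same way.\<close>

lemma kth_largest_index_cong:
  assumes "\<And>i j. i \<in> I \<Longrightarrow> j \<in> I \<Longrightarrow> E i < E j \<longleftrightarrow> F i < F j"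
  shows "kth_largest_index k I E = kth_largest_index k I F"
proof -
  have "E i \<ge> E j \<longleftrightarrow> F i \<ge> F j" if "i \<in> I" "j \<in> I" for i j
    using assms[OF that] by linarith
  then show ?thesis
    unfolding kth_largest_index_def using assms
    by (intro arg_cong[where f = Least] ext conj_cong refl) (auto intro!: arg_cong[where f = card] arg_cong2[where f = "(<)"] arg_cong2[where f = "(\<le>)"])
qed

text \<open>The index \<open>i\<close> is selected iff some \<open>(k - 1)\<close>-set \<open>S\<close> of other indices lies above it and the
  rest below it; these events are disjoint for distinct pairs \<open>(i, S)\<close> and equally likely.\<close>

lemma (in prob_space) prob_kth_largest_exponential:
  fixes G H :: "nat \<Rightarrow> 'a \<Rightarrow> real" and \<phi> :: "real \<Rightarrow> real"
  assumes indep: "indep_vars (\<lambda>_. borel) (case_sum G H) (I <+> I)"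
    and G: "\<And>i. i \<in> I \<Longrightarrow> distributed M lborel (G i) (exponential_density 1)"
    and H: "\<And>i. i \<in> I \<Longrightarrow> distributed M lborel (H i) (exponential_density 1)"
    and I: "finite I" and k: "1 \<le> k" "k \<le> card I"
    and \<phi>[measurable]: "\<phi> \<in> borel_measurable borel" and \<phi>0: "\<And>y. 0 < y \<Longrightarrow> 0 \<le> \<phi> y"
    and int: "has_bochner_integral lborel (\<lambda>y. indicator {0<..} y *\<^sub>R
      (exp (- (real k * y)) * (1 - exp (- y)) ^ (card I - k) * exp (- \<phi> y))) v"
  shows "prob {\<omega> \<in> space M. \<exists>i\<in>I. kth_largest_index k I (\<lambda>i. G i \<omega>) = i \<and> \<phi> (G i \<omega>) < H i \<omega>} =
    real k * real (card I choose k) * v"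
proof -
  have mG[measurable]: "G i \<in> borel_measurable M" and mH[measurable]: "H i \<in> borel_measurable M"
    if "i \<in> I" for i
    using distributed_measurable[OF G[OF that]] distributed_measurable[OF H[OF that]] by simp_all
  define N where "N = (\<lambda>(i, S). {\<omega> \<in> space M. (\<forall>j\<in>S. G i \<omega> < G j \<omega>) \<and>
    (\<forall>j\<in>I - {i} - S. G j \<omega> < G i \<omega>) \<and> \<phi> (G i \<omega>) < H i \<omega>})"
  define T where "T = (SIGMA i:I. {S. S \<subseteq> I - {i} \<and> card S = k - 1})"
  have T: "finite T" using I unfolding T_def by (intro finite_SigmaI) auto
  have card: "card T = k * (card I choose k)"
  proof -
    have "card {S. S \<subseteq> I - {i} \<and> card S = k - 1} = (card I - 1) choose (k - 1)" if "i \<in> I" for i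
      using n_subsets[of "I - {i}" "k - 1"] I that by simp
    \<comment> \<open>Choices of \<open>i\<close> times choices of \<open>S\<close>. The absorption
      identity \<open>n * ((n - 1) choose (k - 1)) = k * (n choose k)\<close> turns this into the
      prefactor of the formula.\<close>
    then have "card T = card I * ((card I - 1) choose (k - 1))"
      using I unfolding T_def by (subst card_SigmaI) auto
    then show ?thesis using times_binomial_minus1_eq[of k "card I"] k by simp
  qed
  have N: "N p \<in> sets M" if p: "p \<in> T" for p
  proof -
    obtain i S where p': "p = (i, S)" "i \<in> I" "S \<subseteq> I" using p unfolding T_def by auto
    then have [measurable]: "finite S" "finite (I - {i} - S)" "G i \<in> borel_measurable M" "H i \<in> borel_measurable M"
      using I finite_subset by auto
    have "Measurable.pred M (\<lambda>\<omega>. \<forall>j\<in>S. G i \<omega> < G j \<omega>)"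
      using p' by (intro pred_intros_finite \<open>finite S\<close>) (auto intro!: borel_measurable_pred_less)
    moreover have "Measurable.pred M (\<lambda>\<omega>. \<forall>j\<in>I - {i} - S. G j \<omega> < G i \<omega>)"
      using p' by (intro pred_intros_finite \<open>finite (I - {i} - S)\<close>) (auto intro!: borel_measurable_pred_less)
    ultimately show ?thesis unfolding N_def p' by simp
  qed
  have prob_N: "prob (N p) = v" if p: "p \<in> T" for p
  proof -
    obtain i S where p': "p = (i, S)" "i \<in> I" "S \<subseteq> I - {i}" "card S = k - 1"
      using p unfolding T_def by auto
    have "Suc (card S) = k" using p' k by simp
    then have "emeasure M (N p) = (\<integral>\<^sup>+ y. ennreal (indicator {0<..} y *\<^sub>R
      (exp (- (real k * y)) * (1 - exp (- y)) ^ (card I - k) * exp (- \<phi> y))) \<partial>lborel)"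
      using emeasure_exponential_separated[OF indep G H I p'(2,3) \<phi> \<phi>0] by (simp add: N_def p'(1))
    also have "\<dots> = ennreal v"
      using int by (subst nn_integral_eq_integral)
        (auto simp: has_bochner_integral_iff indicator_def intro!: AE_I2)
    \<comment> \<open>Reading \<open>v\<close> back from \<open>ennreal v\<close> requires
      \<open>0 \<le> v\<close>, which holds because the integrand is nonnegative.\<close>
    finally show ?thesis
      using int by (auto simp: measure_def has_bochner_integral_iff intro!: integral_nonneg_AE AE_I2
          simp: indicator_def)
  qed
  \<comment> \<open>The outcome and \<open>i\<close> together determine \<open>S\<close>, so
    disjointness reduces to showing that the outcome determines \<open>i\<close>.\<close>
  have N_above: "S = {j \<in> I. G i \<omega> < G j \<omega>}" if "(i, S) \<in> T" "\<omega> \<in> N (i, S)" for i S \<omega>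
  proof -
    have "S \<subseteq> I" and gt: "\<And>j. j \<in> S \<Longrightarrow> G i \<omega> < G j \<omega>"
      and lt: "\<And>j. j \<in> I - {i} - S \<Longrightarrow> G j \<omega> < G i \<omega>"
      using that by (auto simp: T_def N_def)
    moreover have "j \<in> S" if "j \<in> I" "G i \<omega> < G j \<omega>" for j
    proof (rule ccontr)
      assume "j \<notin> S"
      then have "G j \<omega> < G i \<omega>" using that by (intro lt) auto
      then show False using that by simp
    qed
    ultimately show ?thesis by blast
  qed
  have disj: "disjoint_family_on N T"
    unfolding disjoint_family_on_def
  proof (intro ballI impI, rule ccontr)
    fix p q assume pq: "p \<in> T" "q \<in> T" "p \<noteq> q" "N p \<inter> N q \<noteq> {}"
    obtain i S i' S' where pq_eq: "p = (i, S)" "q = (i', S')" by (cases p, cases q)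
    then have p: "(i, S) \<in> T" "i \<in> I" "card S = k - 1" and q: "(i', S') \<in> T" "i' \<in> I" "card S' = k - 1"
      using pq(1,2) by (auto simp: T_def)
    obtain \<omega> where w: "\<omega> \<in> N (i, S)" "\<omega> \<in> N (i', S')" using pq(4) pq_eq by blast
    note S = N_above[OF p(1) w(1)] and S' = N_above[OF q(1) w(2)]
    have less: "card {j \<in> I. G b \<omega> < G j \<omega>} < card {j \<in> I. G a \<omega> < G j \<omega>}"
      if "G a \<omega> < G b \<omega>" "b \<in> I" for a b
      using that I by (intro psubset_card_mono) auto
    \<comment> \<open>Inside \<open>N (i, S)\<close> every other index is strictly above or strictly
      below \<open>i\<close>. Two distinct selected indices would thus have different numbers of
      larger gains, yet both numbers are \<open>k - 1\<close>.\<close>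
    have "i = i'"
    proof (rule ccontr)
      assume "i \<noteq> i'"
      then have "i' \<in> I - {i}" using q(2) by simp
      then have "G i \<omega> < G i' \<omega> \<or> G i' \<omega> < G i \<omega>"
        using w(1) by (cases "i' \<in> S") (auto simp: N_def)
      then show False using less[of i i'] less[of i' i] p(2,3) q(2,3) S S' by auto
    qed
    then show False using pq(3) pq_eq S S' by simp
  qed
  have ne: "AE \<omega> in M. G i \<omega> \<noteq> G j \<omega>" if "i \<in> I" "j \<in> I" "i \<noteq> j" for i j
  proof -
    have "indep_vars (\<lambda>_. borel) (case_sum G H) {Inl i, Inl j}"
      using that by (intro indep_vars_subset[OF indep]) auto
    from AE_indep_exponential_neq[OF this] that G show ?thesis by auto
  qed
  have inj: "AE \<omega> in M. inj_on (\<lambda>i. G i \<omega>) I"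
  proof -
    have "AE \<omega> in M. \<forall>i\<in>I. \<forall>j\<in>I. i \<noteq> j \<longrightarrow> G i \<omega> \<noteq> G j \<omega>"
      using ne I by (intro AE_finite_allI) auto
    then show ?thesis by eventually_elim (auto simp: inj_on_def)
  qed
  \<comment> \<open>The two events agree wherever the gains are distinct, because there the selected
    index is characterised by its count of larger gains.\<close>
  have "prob {\<omega> \<in> space M. \<exists>i\<in>I. kth_largest_index k I (\<lambda>i. G i \<omega>) = i \<and> \<phi> (G i \<omega>) < H i \<omega>} =
      prob (\<Union>p\<in>T. N p)"
  proof (rule finite_measure_eq_AE)
    show "AE \<omega> in M. (\<omega> \<in> {\<omega> \<in> space M. \<exists>i\<in>I. kth_largest_index k I (\<lambda>i. G i \<omega>) = i \<and> \<phi> (G i \<omega>) < H i \<omega>}) =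
        (\<omega> \<in> (\<Union>p\<in>T. N p))"
      using inj
    proof (eventually_elim, intro iffI)
      fix \<omega> assume inj: "inj_on (\<lambda>i. G i \<omega>) I"
        and "\<omega> \<in> {\<omega> \<in> space M. \<exists>i\<in>I. kth_largest_index k I (\<lambda>i. G i \<omega>) = i \<and> \<phi> (G i \<omega>) < H i \<omega>}"
      then obtain i where i: "\<omega> \<in> space M" "i \<in> I" "kth_largest_index k I (\<lambda>i. G i \<omega>) = i" "\<phi> (G i \<omega>) < H i \<omega>"
        by auto
      let ?S = "{j \<in> I. G i \<omega> < G j \<omega>}"
      have "card ?S = k - 1"
        using kth_largest_index_eq_iff[OF I inj k i(2)] i(3) by simp
      then have "(i, ?S) \<in> T" using i(2) by (auto simp: T_def)
      \<comment> \<open>Absence of ties upgrades "not above \<open>i\<close>" to "strictly below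
        \<open>i\<close>".\<close>
      moreover have "\<omega> \<in> N (i, ?S)"
        using i inj by (auto simp: N_def inj_on_def not_less less_le)
      ultimately show "\<omega> \<in> (\<Union>p\<in>T. N p)" by blast
    next
      fix \<omega> assume inj: "inj_on (\<lambda>i. G i \<omega>) I" and "\<omega> \<in> (\<Union>p\<in>T. N p)"
      then obtain i S where iS: "(i, S) \<in> T" "\<omega> \<in> N (i, S)" by auto
      then have i: "i \<in> I" "card S = k - 1" by (auto simp: T_def)
      have "S = {j \<in> I. G i \<omega> < G j \<omega>}" by (rule N_above[OF iS])
      then have "kth_largest_index k I (\<lambda>i. G i \<omega>) = i"
        using kth_largest_index_eq_iff[OF I inj k i(1)] i(2) by simp
      then show "\<omega> \<in> {\<omega> \<in> space M. \<exists>i\<in>I. kth_largest_index k I (\<lambda>i. G i \<omega>) = i \<and> \<phi> (G i \<omega>) < H i \<omega>}"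
        using iS i by (auto simp: N_def)
    qed
    have [measurable]: "(\<lambda>\<omega>. kth_largest_index k I (\<lambda>i. G i \<omega>)) \<in> M \<rightarrow>\<^sub>M count_space UNIV"
      using mG I by (rule measurable_kth_largest_index)
    have "Measurable.pred M (\<lambda>\<omega>. \<exists>i\<in>I. kth_largest_index k I (\<lambda>i. G i \<omega>) = i \<and> \<phi> (G i \<omega>) < H i \<omega>)"
    proof (intro pred_intros_finite I)
      fix i assume "i \<in> I"
      note [measurable] = mG[OF this] mH[OF this]
      show "Measurable.pred M (\<lambda>\<omega>. kth_largest_index k I (\<lambda>i. G i \<omega>) = i \<and> \<phi> (G i \<omega>) < H i \<omega>)"
        by measurable
    qed
    then show "{\<omega> \<in> space M. \<exists>i\<in>I. kth_largest_index k I (\<lambda>i. G i \<omega>) = i \<and> \<phi> (G i \<omega>) < H i \<omega>} \<in> sets M"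
      by simp
    show "(\<Union>p\<in>T. N p) \<in> sets M" using T N by auto
  qed
  also have "\<dots> = (\<Sum>p\<in>T. prob (N p))"
    using T N disj by (intro finite_measure_finite_Union) auto
  also have "\<dots> = real (card T) * v" using prob_N by simp
  finally show ?thesis by (simp add: card)
qed

section \<open>Harvested energy and SNR as functions of the gains\<close>

text \<open>Over a common denominator the term \<open>b * c\<close> cancels, and the numerator
  becomes proportional to the gain with the factor \<open>a * c - b\<close>.\<close>

lemma harvested_energy_eq:
  assumes "0 < P" "0 < c" "0 < \<gamma>"
  shows "harvested_energy a b c P t \<gamma> = t * (a * c - b) * (P * \<gamma>) / (c * (P * \<gamma> + c))"
proof -
  have "P * \<gamma> + c \<noteq> 0" using assms by (simp add: add_pos_pos less_imp_neq[symmetric])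
  then show ?thesis
    using assms unfolding harvested_energy_def by (simp add: field_simps)
qed

text \<open>Up to the positive factor \<open>t * (a * c - b) / c\<close>, the energy is
  \<open>u / (u + c)\<close> with \<open>u = P * \<gamma>\<close>, which is strictly increasing in
  \<open>u > 0\<close> because \<open>c > 0\<close>.\<close>

lemma harvested_energy_less_iff:
  assumes "0 < P" "0 < c" "0 < t" "0 < a * c - b" "0 < \<gamma>" "0 < \<gamma>'"
  shows "harvested_energy a b c P t \<gamma> < harvested_energy a b c P t \<gamma>' \<longleftrightarrow> \<gamma> < \<gamma>'"
proof -
  define u v where "u = P * \<gamma>" and "v = P * \<gamma>'"
  have uv: "0 < u" "0 < v" using assms by (simp_all add: u_def v_def)
  have eq: "harvested_energy a b c P t \<gamma> = (t * (a * c - b) / c) * (u / (u + c))"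
    "harvested_energy a b c P t \<gamma>' = (t * (a * c - b) / c) * (v / (v + c))"
    using assms by (simp_all add: harvested_energy_eq u_def v_def)
  have "0 < t * (a * c - b) / c" using assms by simp
  then have "harvested_energy a b c P t \<gamma> < harvested_energy a b c P t \<gamma>' \<longleftrightarrow> u / (u + c) < v / (v + c)"
    unfolding eq by (rule mult_less_cancel_left_pos)
  also have "\<dots> \<longleftrightarrow> u * (v + c) < v * (u + c)"
    using uv assms by (simp add: divide_less_eq less_divide_eq field_simps)
  also have "\<dots> \<longleftrightarrow> u < v" using assms by (simp add: algebra_simps)
  also have "\<dots> \<longleftrightarrow> \<gamma> < \<gamma>'" using assms by (simp add: u_def v_def)
  finally show ?thesis .
qed

text \<open>The energy is positive, so the condition solves to a lower bound on
  \<open>\<eta>\<close> proportional to its reciprocal. That reciprocal is affine in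
  \<open>1 / \<gamma>\<close>, since
  \<open>(P * \<gamma> + c) / (P * \<gamma>) = 1 + c / (P * \<gamma>)\<close>.\<close>

lemma less_snr_iff:
  assumes "0 < P" "0 < c" "0 < t\<^sub>1" "0 < t\<^sub>2" "0 < s" "0 < a * c - b" "0 < \<gamma>"
  shows "x < snr s t\<^sub>2 \<eta> (harvested_energy a b c P t\<^sub>1 \<gamma>) \<longleftrightarrow>
    s * c * t\<^sub>2 * x / (t\<^sub>1 * (a * c - b)) + s * c\<^sup>2 * t\<^sub>2 * x / (P * t\<^sub>1 * (a * c - b)) / \<gamma> < \<eta>"
proof -
  define d where "d = a * c - b"
  define E where "E = t\<^sub>1 * d * (P * \<gamma>) / (c * (P * \<gamma> + c))"
  have d: "0 < d" using assms by (simp add: d_def)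
  have q: "0 < P * \<gamma> + c" using assms by (simp add: add_pos_pos)
  have E: "0 < E" using assms d q by (simp add: E_def)
  have "x < \<eta> / (t\<^sub>2 * s) * E \<longleftrightarrow> x * (t\<^sub>2 * s) / E < \<eta>"
    using assms E by (simp add: field_simps)
  also have "x * (t\<^sub>2 * s) / E = s * c * t\<^sub>2 * x / (t\<^sub>1 * d) + s * c\<^sup>2 * t\<^sub>2 * x / (P * t\<^sub>1 * d) / \<gamma>"
    using assms d q unfolding E_def by (simp add: field_simps power2_eq_square)
  finally show ?thesis
    using assms by (simp add: snr_def harvested_energy_eq E_def d_def)
qed

section \<open>Outage probability of energy-based selection\<close>

theorem theorem3:
  fixes \<Omega> :: "'a measure"
    and G H :: "nat \<Rightarrow> 'a \<Rightarrow> real"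
    and M k :: nat
    and P\<^sub>t \<sigma>\<^sub>n t\<^sub>1 t\<^sub>2 a b c x :: real
  assumes "prob_space \<Omega>"
    and "1 \<le> M"
    and "prob_space.indep_vars \<Omega> (\<lambda>_. borel) (case_sum G H) ({1..M} <+> {1..M})"
    and "\<And>i. i \<in> {1..M} \<Longrightarrow> distributed \<Omega> lborel (G i) (exponential_density 1)"
    and "\<And>i. i \<in> {1..M} \<Longrightarrow> distributed \<Omega> lborel (H i) (exponential_density 1)"
    and "0 < P\<^sub>t" and "0 < \<sigma>\<^sub>n\<^sup>2"
    and "0 < t\<^sub>1" and "t\<^sub>1 < 1" and "t\<^sub>2 = 1 - t\<^sub>1"
    and "0 < c" and "0 < a * c - b"
    and "1 \<le> k" and "k \<le> M"
    and "0 < x"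
  shows
    "let E = (\<lambda>i \<omega>. harvested_energy a b c P\<^sub>t t\<^sub>1 (G i \<omega>));
         X = (\<lambda>i \<omega>. snr (\<sigma>\<^sub>n\<^sup>2) t\<^sub>2 (H i \<omega>) (E i \<omega>));
         istar = (\<lambda>\<omega>. kth_largest_index k {1..M} (\<lambda>i. E i \<omega>));
         \<Phi> = (\<lambda>m. exp (- (\<sigma>\<^sub>n\<^sup>2 * c * t\<^sub>2 * x / (t\<^sub>1 * (a * c - b)))) * sqrt (c\<^sup>2 / (a * c - b))
                 * bessel_K 1 (2 * sqrt (\<sigma>\<^sub>n\<^sup>2 * c\<^sup>2 * t\<^sub>2 * x / (P\<^sub>t * t\<^sub>1 * (a * c - b)) * real (k + m))))
     in measure \<Omega> {\<omega> \<in> space \<Omega>. X (istar \<omega>) \<omega> \<le> x} =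
          1 - 2 * real k * real (M choose k) * sqrt (\<sigma>\<^sub>n\<^sup>2 * t\<^sub>2 * x / (P\<^sub>t * t\<^sub>1))
            * (\<Sum>m = 0..M - k. (-1) ^ m * real ((M - k) choose m) * (\<Phi> m / sqrt (real (k + m))))"
proof -
  interpret prob_space \<Omega> by (rule assms(1))
  let ?I = "{1..M}"
  define E where "E = (\<lambda>i \<omega>. harvested_energy a b c P\<^sub>t t\<^sub>1 (G i \<omega>))"
  define X where "X = (\<lambda>i \<omega>. snr (\<sigma>\<^sub>n\<^sup>2) t\<^sub>2 (H i \<omega>) (E i \<omega>))"
  define istar where "istar = (\<lambda>\<omega>. kth_largest_index k ?I (\<lambda>i. E i \<omega>))"
  \<comment> \<open>\<open>A\<close> and \<open>B\<close> are the constants of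
    \<open>less_snr_iff\<close>. \<open>A\<close> becomes the exponent in \<open>\<Phi>\<close>, and
    \<open>B * real (k + m)\<close> the radicand in the Bessel argument.\<close>
  define A where "A = \<sigma>\<^sub>n\<^sup>2 * c * t\<^sub>2 * x / (t\<^sub>1 * (a * c - b))"
  define B where "B = \<sigma>\<^sub>n\<^sup>2 * c\<^sup>2 * t\<^sub>2 * x / (P\<^sub>t * t\<^sub>1 * (a * c - b))"
  define v where "v = exp (- A) * (\<Sum>m\<le>M - k. (-1) ^ m * real ((M - k) choose m) *
      (2 * sqrt (B / real (k + m)) * bessel_K 1 (2 * sqrt (B * real (k + m)))))"
  have t2: "0 < t\<^sub>2" using assms by simp
  have A: "0 < A" and B: "0 < B"
    using assms t2 by (simp_all add: A_def B_def)
  have mG[measurable]: "G i \<in> borel_measurable \<Omega>" and mH[measurable]: "H i \<in> borel_measurable \<Omega>"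
    if "i \<in> ?I" for i
    using distributed_measurable[OF assms(4)[OF that]] distributed_measurable[OF assms(5)[OF that]]
    by simp_all
  have mE: "E i \<in> borel_measurable \<Omega>" if "i \<in> ?I" for i
    using mG[OF that] unfolding E_def harvested_energy_def by measurable
  have mX: "X i \<in> borel_measurable \<Omega>" if "i \<in> ?I" for i
    using mE[OF that] mH[OF that] unfolding X_def snr_def by measurable
  have mistar[measurable]: "istar \<in> \<Omega> \<rightarrow>\<^sub>M count_space UNIV"
    unfolding istar_def using mE by (rule measurable_kth_largest_index) simp_all
  \<comment> \<open>Ties are broken inside the index set, so this holds for every outcome and the
    outage event is exactly the complement of \<open>?gt\<close>.\<close>
  have mem: "istar \<omega> \<in> ?I" for \<omega>
    unfolding istar_def using assms by (intro kth_largest_index_mem) auto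
  \<comment> \<open>The existential turns the random index into a finite union of events with fixed
    \<open>i\<close>, which gives measurability.\<close>
  let ?gt = "{\<omega> \<in> space \<Omega>. \<exists>i\<in>?I. istar \<omega> = i \<and> x < X i \<omega>}"
  let ?gain = "{\<omega> \<in> space \<Omega>. \<exists>i\<in>?I. kth_largest_index k ?I (\<lambda>i. G i \<omega>) = i \<and> A + B / G i \<omega> < H i \<omega>}"
  have gt: "?gt \<in> events"
  proof -
    have "Measurable.pred \<Omega> (\<lambda>\<omega>. \<exists>i\<in>?I. istar \<omega> = i \<and> x < X i \<omega>)"
    proof (intro pred_intros_finite finite_atLeastAtMost)
      fix i assume "i \<in> ?I"
      note [measurable] = mX[OF this]
      show "Measurable.pred \<Omega> (\<lambda>\<omega>. istar \<omega> = i \<and> x < X i \<omega>)" by measurable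
    qed
    then show ?thesis by simp
  qed
  have gain: "?gain \<in> events"
  proof -
    have [measurable]: "(\<lambda>\<omega>. kth_largest_index k ?I (\<lambda>i. G i \<omega>)) \<in> \<Omega> \<rightarrow>\<^sub>M count_space UNIV"
      using mG by (rule measurable_kth_largest_index) simp_all
    have "Measurable.pred \<Omega> (\<lambda>\<omega>. \<exists>i\<in>?I. kth_largest_index k ?I (\<lambda>i. G i \<omega>) = i \<and> A + B / G i \<omega> < H i \<omega>)"
    proof (intro pred_intros_finite finite_atLeastAtMost)
      fix i assume "i \<in> ?I"
      note [measurable] = mG[OF this] mH[OF this]
      show "Measurable.pred \<Omega> (\<lambda>\<omega>. kth_largest_index k ?I (\<lambda>i. G i \<omega>) = i \<and> A + B / G i \<omega> < H i \<omega>)"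
        by measurable
    qed
    then show ?thesis by simp
  qed
  \<comment> \<open>Positive gains are needed both for the monotonicity of the energy and for the
    threshold form of the SNR condition.\<close>
  have "AE \<omega> in \<Omega>. \<forall>i\<in>?I. 0 < G i \<omega>"
  proof (rule AE_finite_allI)
    fix i assume i: "i \<in> ?I"
    note [measurable] = mG[OF i]
    have "prob {\<omega> \<in> space \<Omega>. 0 < G i \<omega>} = 1"
      using exponential_distributedD_gt[OF assms(4)[OF i], of 0] by simp
    then show "AE \<omega> in \<Omega>. 0 < G i \<omega>" by (subst (asm) prob_Collect_eq_1) auto
  qed simp
  then have "AE \<omega> in \<Omega>. \<omega> \<in> ?gt \<longleftrightarrow> \<omega> \<in> ?gain"
  proof eventually_elim
    case (elim \<omega>)
    have "istar \<omega> = kth_largest_index k ?I (\<lambda>i. G i \<omega>)"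
      unfolding istar_def E_def
      using elim assms by (intro kth_largest_index_cong harvested_energy_less_iff) auto
    moreover have "x < X i \<omega> \<longleftrightarrow> A + B / G i \<omega> < H i \<omega>" if "i \<in> ?I" for i
      unfolding X_def E_def A_def B_def using elim assms that t2 by (intro less_snr_iff) auto
    ultimately show ?case by auto
  qed
  then have "prob ?gt = prob ?gain"
    using gt gain by (rule finite_measure_eq_AE)
  also have "\<dots> = real k * real (card ?I choose k) * v"
  proof (rule prob_kth_largest_exponential[where \<phi> = "\<lambda>y. A + B / y"])
    show "has_bochner_integral lborel (\<lambda>y. indicator {0<..} y *\<^sub>R
      (exp (- (real k * y)) * (1 - exp (- y)) ^ (card ?I - k) * exp (- (A + B / y)))) v"
      using has_bochner_integral_binomial_bessel_K[OF B assms(13), of "M - k" A]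
      by (simp add: v_def)
  qed (use assms A B in \<open>auto simp: less_imp_le\<close>)
  finally have "prob ?gt = real k * real (M choose k) * v" by simp
  moreover have "{\<omega> \<in> space \<Omega>. X (istar \<omega>) \<omega> \<le> x} = space \<Omega> - ?gt"
    using mem by auto
  ultimately have "prob {\<omega> \<in> space \<Omega>. X (istar \<omega>) \<omega> \<le> x} = 1 - real k * real (M choose k) * v"
    using prob_compl[OF gt] by simp
  also have "v = 2 * sqrt (\<sigma>\<^sub>n\<^sup>2 * t\<^sub>2 * x / (P\<^sub>t * t\<^sub>1)) *
      (\<Sum>m = 0..M - k. (-1) ^ m * real ((M - k) choose m) *
        (exp (- A) * sqrt (c\<^sup>2 / (a * c - b)) * bessel_K 1 (2 * sqrt (B * real (k + m))) / sqrt (real (k + m))))"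
  proof -
    \<comment> \<open>Splitting \<open>B\<close> separates the factor
      \<open>sqrt (c\<^sup>2 / (a * c - b))\<close> kept in \<open>\<Phi>\<close> from the square
      root in front of the sum.\<close>
    have "B = (\<sigma>\<^sub>n\<^sup>2 * t\<^sub>2 * x / (P\<^sub>t * t\<^sub>1)) * (c\<^sup>2 / (a * c - b))"
      by (simp add: B_def)
    then have sB: "sqrt B = sqrt (\<sigma>\<^sub>n\<^sup>2 * t\<^sub>2 * x / (P\<^sub>t * t\<^sub>1)) * sqrt (c\<^sup>2 / (a * c - b))"
      by (simp only: real_sqrt_mult)
    show ?thesis
      unfolding v_def real_sqrt_divide[of B] sB atLeast0AtMost sum_distrib_left
      by (intro sum.cong refl) simp
  qed
  finally show ?thesis
    unfolding Let_def E_def X_def istar_def A_def B_def by (simp only: mult_ac)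
qed

end
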